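(* For any positive integers $m,p$ there exists $q=q(m,p)$ with the following property. If $\psi$ is an edge coloring of $K_{qm}$, and $K=K_{q,\dots,q}$ is a spanning complete $m$-partite subgraph of $K_{qm}$ with all classes of size $q$ which is rainbow under $\psi$, then $K$ contains a (rainbow) complete $m$-partite subgraph $K'=K_{p,\dots,p}$ of order $pm$ (with $m$ vertex classes of size $p$ each) such that the colors of the edges of $K_{qm}$ lying inside the vertex classes of $K'$ do not occur in $K'$.
   Context: An edge-colored graph is rainbow if all its edges have pairwise distinct colors. An edge coloring is an arbitrary assignment of colors to the edges (not necessarily proper). *)

theory Defs
  imports Main "HOL-Library.Disjoint_Sets"
begin

text \<open>Simple undirected graphs: a vertex set together with a set of two-element vertex sets.\<close>

type_synonym 'v graph = "'v set \<times> 'v set set"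

abbreviation verts :: "'v graph \<Rightarrow> 'v set" where "verts \<equiv> fst"
abbreviation edges :: "'v graph \<Rightarrow> 'v set set" where "edges \<equiv> snd"

definition complete_graph :: "'v set \<Rightarrow> 'v graph" where
  "complete_graph V = (V, {{u, v} | u v. u \<in> V \<and> v \<in> V \<and> u \<noteq> v})"

definition subgraph :: "'v graph \<Rightarrow> 'v graph \<Rightarrow> bool" where
  "subgraph H G \<longleftrightarrow> verts H \<subseteq> verts G \<and> edges H \<subseteq> edges G"

definition spanning_subgraph :: "'v graph \<Rightarrow> 'v graph \<Rightarrow> bool" where
  "spanning_subgraph H G \<longleftrightarrow> subgraph H G \<and> verts H = verts G"

text \<open>\<open>complete_multipartite m q C G\<close>: the graph \<open>G\<close> is a \<open>K_{q,...,q}\<close> with \<open>m\<close> vertex classes,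
  and \<open>C\<close> is its set of vertex classes. Classes are collected in a set rather than an indexed
  family, which is appropriate only for \<open>q > 0\<close> (there is just one empty set).\<close>

definition complete_multipartite :: "nat \<Rightarrow> nat \<Rightarrow> 'v set set \<Rightarrow> 'v graph \<Rightarrow> bool" where
  "complete_multipartite m q C G \<longleftrightarrow>
     finite C \<and> card C = m \<and> (\<forall>A\<in>C. finite A \<and> card A = q) \<and> disjoint C \<and>
     verts G = \<Union>C \<and>
     edges G = {{u, v} | u v. \<exists>A\<in>C. \<exists>B\<in>C. A \<noteq> B \<and> u \<in> A \<and> v \<in> B}"

text \<open>Edge colorings are arbitrary total functions on vertex sets; only their values on edges matter.\<close>

definition rainbow :: "('v set \<Rightarrow> 'c) \<Rightarrow> 'v graph \<Rightarrow> bool" where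
  "rainbow \<psi> G \<longleftrightarrow> inj_on \<psi> (edges G)"

definition edges_inside :: "'v graph \<Rightarrow> 'v set set \<Rightarrow> 'v set set" where
  "edges_inside G C = {e \<in> edges G. \<exists>A\<in>C. e \<subseteq> A}"

end

theory Submission
  imports Defs "HOL-Library.FuncSet"
begin

text \<open>
  Since \<open>K\<close> is rainbow, every edge \<open>e\<close> inside a class \<open>A\<close> shares its color with at most one edge
  \<open>f\<close> of \<open>K\<close>, and \<open>f\<close>, joining two classes, has an endpoint \<open>w\<close> outside \<open>A\<close>. A choice of
  \<open>p\<close>-subsets of the classes can therefore only fail by containing both \<open>e\<close> and \<open>w\<close>.

  Cut each class into \<open>n\<close> blocks of size \<open>p\<close> and let the new class be one of these blocks. There are
  at most \<open>m n p\<^sup>2\<close> edges inside blocks, and such an edge \<open>e\<close> rules out just one pair of blocks in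
  two different classes: the block of \<open>e\<close> together with the block of \<open>w\<close>. A fixed pair of blocks
  occurs in a fraction \<open>1 / n\<^sup>2\<close> of all \<open>n ^ m\<close> choices. So if \<open>m n p\<^sup>2 < n\<^sup>2\<close>, some choice contains
  no ruled-out pair; \<open>n = m p\<^sup>2 + 1\<close>, hence \<open>q = (m p\<^sup>2 + 1) p\<close>, is enough. The counting is
  \<open>choice_avoiding_pairs\<close>, and \<open>classes_avoiding_inner_colors\<close> applies it to the blocks.
\<close>

lemma disjoint_blocks_exist:
  assumes "finite A" and "card A = n * p" and "p > 0"
  shows "\<exists>P. finite P \<and> card P = n \<and> disjoint P \<and> (\<forall>X\<in>P. X \<subseteq> A \<and> card X = p)"
  using assms
proof (induction n arbitrary: A)
  case 0
  show ?case by (rule exI[of _ "{}"]) simp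
next
  case (Suc n)
  obtain X where X: "X \<subseteq> A" "card X = p" "finite X"
    using obtain_subset_with_card_n[of p A] Suc.prems by auto
  have "card (A - X) = n * p"
    using X Suc.prems by (simp add: card_Diff_subset)
  then obtain P where P: "finite P" "card P = n" "disjoint P" "\<forall>Y\<in>P. Y \<subseteq> A - X \<and> card Y = p"
    using Suc.IH[of "A - X"] Suc.prems by auto
  have apart: "X \<inter> Y = {}" if "Y \<in> P" for Y using P(4) that by auto
  have "X \<noteq> {}" using X(2) Suc.prems(3) by auto
  then have "X \<notin> P" using apart by fastforce
  moreover have "disjoint (insert X P)"
    using P(3) apart by (simp add: disjoint_def Int_commute)
  ultimately show ?case
    using P X by (intro exI[of _ "insert X P"]) auto
qed

lemma card_choices_with_two_prescribed:
  assumes "finite I" and "\<And>i. i \<in> I \<Longrightarrow> card (P i) = n"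
    and "i \<in> I" "j \<in> I" "i \<noteq> j" and "x \<in> P i" "y \<in> P j"
  shows "card {t \<in> Pi\<^sub>E I P. t i = x \<and> t j = y} * n\<^sup>2 = n ^ card I"
proof -
  let ?Q = "\<lambda>k. if k = i then {x} else if k = j then {y} else P k"
  have "{t \<in> Pi\<^sub>E I P. t i = x \<and> t j = y} = Pi\<^sub>E I ?Q"
    using assms by (fastforce simp: PiE_iff split: if_splits)
  moreover have "card (Pi\<^sub>E I ?Q) = (\<Prod>k\<in>I. card (?Q k))"
    using assms(1) by (rule card_PiE)
  moreover have "(\<Prod>k\<in>I. card (?Q k)) = (\<Prod>k\<in>I - {i} - {j}. card (?Q k))"
    using assms by (simp add: prod.remove[of I i] prod.remove[of "I - {i}" j])
  moreover have "(\<Prod>k\<in>I - {i} - {j}. card (?Q k)) = (\<Prod>k\<in>I - {i} - {j}. n)"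
    using assms by (intro prod.cong) auto
  moreover have "card I = Suc (Suc (card (I - {i} - {j})))"
    using assms by (metis card.remove finite_Diff insert_Diff insert_iff)
  ultimately show ?thesis by (simp add: power2_eq_square)
qed

text \<open>The union bound: each forbidden pair excludes a fraction \<open>1 / n\<^sup>2\<close> of the choices, so fewer than
  \<open>n\<^sup>2\<close> pairs cannot exclude all of them.\<close>

lemma choice_avoiding_pairs:
  assumes "finite I" and "n > 0" and "\<And>i. i \<in> I \<Longrightarrow> card (P i) = n"
    and "finite F" and "card F < n\<^sup>2"
    and F: "\<And>i x j y. ((i, x), (j, y)) \<in> F \<Longrightarrow> i \<in> I \<and> j \<in> I \<and> i \<noteq> j \<and> x \<in> P i \<and> y \<in> P j"
  obtains t where "t \<in> Pi\<^sub>E I P" and "\<And>i x j y. ((i, x), (j, y)) \<in> F \<Longrightarrow> \<not> (t i = x \<and> t j = y)"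
proof -
  define B where "B = (\<lambda>((i, x), (j, y)). {t \<in> Pi\<^sub>E I P. t i = x \<and> t j = y})"
  have each: "card (B f) * n\<^sup>2 = n ^ card I" if "f \<in> F" for f
  proof -
    obtain i x j y where f: "f = ((i, x), (j, y))" by (metis surj_pair)
    show ?thesis
      using F[of i x j y] that assms(1,3) unfolding f B_def
      by (simp add: card_choices_with_two_prescribed)
  qed
  have "card (\<Union>f\<in>F. B f) * n\<^sup>2 \<le> (\<Sum>f\<in>F. card (B f)) * n\<^sup>2"
    using card_UN_le[OF assms(4)] by (rule mult_right_mono) simp
  also have "\<dots> = (\<Sum>f\<in>F. n ^ card I)"
    unfolding sum_distrib_right using each by (rule sum.cong[OF refl])
  also have "\<dots> < n\<^sup>2 * n ^ card I"
    using assms(2,5) by simp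
  also have "\<dots> = card (Pi\<^sub>E I P) * n\<^sup>2"
    using assms(1,3) by (simp add: card_PiE)
  finally have "card (\<Union>f\<in>F. B f) < card (Pi\<^sub>E I P)" by simp
  then have "(\<Union>f\<in>F. B f) \<noteq> Pi\<^sub>E I P" by (rule contrapos_pn) simp
  moreover have "(\<Union>f\<in>F. B f) \<subseteq> Pi\<^sub>E I P" unfolding B_def by auto
  ultimately obtain t where t: "t \<in> Pi\<^sub>E I P" "t \<notin> (\<Union>f\<in>F. B f)" by blast
  show ?thesis
  proof (rule that[OF t(1)])
    show "\<not> (t i = x \<and> t j = y)" if "((i, x), (j, y)) \<in> F" for i x j y
      using t that unfolding B_def by force
  qed
qed

text \<open>The pairs of blocks to be avoided are indexed by the ordered pairs \<open>(u, v)\<close> inside blocks, of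
  which there are \<open>card C * n * p\<^sup>2 < n\<^sup>2\<close>. One pair of blocks for each \<open>(u, v)\<close> is enough because
  \<open>\<psi>\<close> is injective on \<open>E\<close>: only one member of \<open>E\<close> has the color of \<open>{u, v}\<close>.\<close>

lemma classes_avoiding_inner_colors:
  fixes \<psi> :: "'v set \<Rightarrow> 'c" and C :: "'v set set"
  assumes "finite C" and "p > 0"
    and size: "\<And>A. A \<in> C \<Longrightarrow> finite A \<and> card A = (card C * p\<^sup>2 + 1) * p"
    and "disjoint C" and inj: "inj_on \<psi> E"
    and E: "\<And>f. f \<in> E \<Longrightarrow> \<exists>w z. f = {w, z} \<and> (\<forall>A\<in>C. \<not> {w, z} \<subseteq> A)"
  obtains S where "\<And>A. A \<in> C \<Longrightarrow> S A \<subseteq> A \<and> card (S A) = p"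
    and "\<And>A u v f. \<lbrakk>A \<in> C; u \<in> S A; v \<in> S A; f \<in> E; f \<subseteq> (\<Union>B\<in>C. S B)\<rbrakk> \<Longrightarrow> \<psi> f \<noteq> \<psi> {u, v}"
proof -
  define n where "n = card C * p\<^sup>2 + 1"
  have "\<forall>A\<in>C. \<exists>P. finite P \<and> card P = n \<and> disjoint P \<and> (\<forall>X\<in>P. X \<subseteq> A \<and> card X = p)"
    using size assms(2) unfolding n_def by (blast intro!: disjoint_blocks_exist)
  from bchoice[OF this] obtain P
    where PA: "\<forall>A\<in>C. finite (P A) \<and> card (P A) = n \<and> disjoint (P A) \<and> (\<forall>X\<in>P A. X \<subseteq> A \<and> card X = p)"
    by blast
  then have P: "\<And>A. A \<in> C \<Longrightarrow> finite (P A) \<and> card (P A) = n \<and> disjoint (P A)"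
    and block: "\<And>A X. A \<in> C \<Longrightarrow> X \<in> P A \<Longrightarrow> X \<subseteq> A \<and> card X = p"
    by simp_all
  have same: "A = B \<and> X = Y" if "A \<in> C" "B \<in> C" "X \<in> P A" "Y \<in> P B" "w \<in> X" "w \<in> Y" for A B X Y w
  proof -
    have "w \<in> A" "w \<in> B" using that block[of A X] block[of B Y] by auto
    then have "A = B" using disjointD[OF assms(4), of A B] that(1,2) by auto
    moreover have "disjoint (P A)" using P that(1) by simp
    ultimately show ?thesis using disjointD[of "P A" X Y] that by auto
  qed
  \<comment> \<open>Not choosing \<open>X\<close> and \<open>Y\<close> together is sufficient to separate \<open>{u, v}\<close>, inside the block \<open>X\<close> of \<open>A\<close>,
    from the edge of its color; \<open>B \<noteq> A\<close> makes this a condition on two independent choices.\<close>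
  define conflict where "conflict = (\<lambda>(A, X :: 'v set, u, v) (B, Y). B \<in> C \<and> B \<noteq> A \<and> Y \<in> P B \<and>
    (\<exists>f\<in>E. \<exists>w\<in>f. w \<in> Y \<and> \<psi> f = \<psi> {u, v}))"
  \<comment> \<open>If both endpoints of the edge colored like \<open>{u, v}\<close> lie outside \<open>A\<close>, there are two conflicts;
    avoiding an arbitrary one of them already keeps that edge out.\<close>
  define g where "g = (\<lambda>d. SOME b. conflict d b)"
  define D where "D = {d \<in> (SIGMA A:C. SIGMA X:P A. X \<times> X). \<exists>b. conflict d b}"
  define F where "F = (\<lambda>(A, X, u, v). ((A, X), g (A, X, u, v))) ` D"
  have g: "conflict d (g d)" if "d \<in> D" for d
    using that unfolding D_def g_def by (auto intro: someI)
  have finX: "finite X" if "A \<in> C" "X \<in> P A" for A X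
    using that block assms(2) by (metis card_ge_0_finite)
  have finD: "finite (SIGMA A:C. SIGMA X:P A. X \<times> X)"
    using assms(1) P finX by (intro finite_SigmaI finite_cartesian_product) blast+
  have "card F \<le> card D"
    unfolding F_def using finD by (intro card_image_le) (auto simp: D_def)
  also have "\<dots> \<le> card (SIGMA A:C. SIGMA X:P A. X \<times> X)"
    by (rule card_mono[OF finD]) (auto simp: D_def)
  also have "\<dots> = (\<Sum>A\<in>C. card (SIGMA X:P A. X \<times> X))"
    using assms(1) P finX by (intro card_SigmaI) (blast intro: finite_SigmaI finite_cartesian_product)+
  also have "\<dots> = (\<Sum>A\<in>C. n * p\<^sup>2)"
  proof (rule sum.cong[OF refl])
    fix A assume A: "A \<in> C"
    have "card (SIGMA X:P A. X \<times> X) = (\<Sum>X\<in>P A. card (X \<times> X))"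
      using A P finX by (intro card_SigmaI) (blast intro: finite_cartesian_product)+
    also have "\<dots> = (\<Sum>X\<in>P A. p\<^sup>2)"
      using A block by (intro sum.cong) (auto simp: card_cartesian_product power2_eq_square)
    finally show "card (SIGMA X:P A. X \<times> X) = n * p\<^sup>2" using A P by simp
  qed
  also have "\<dots> = (card C * p\<^sup>2) * n" by simp
  also have "\<dots> < n * n" unfolding n_def by (rule mult_strict_right_mono) simp_all
  finally have cardF: "card F < n\<^sup>2" by (simp add: power2_eq_square)
  have "finite F"
    unfolding F_def D_def using finD by simp
  have F: "A \<in> C \<and> B \<in> C \<and> A \<noteq> B \<and> X \<in> P A \<and> Y \<in> P B" if "((A, X), (B, Y)) \<in> F" for A X B Y
  proof -
    obtain u v where d: "(A, X, u, v) \<in> D" "g (A, X, u, v) = (B, Y)"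
      using \<open>((A, X), (B, Y)) \<in> F\<close> unfolding F_def by auto
    have "conflict (A, X, u, v) (B, Y)" using g[OF d(1)] d(2) by simp
    then show ?thesis using d(1) unfolding D_def conflict_def by auto
  qed
  obtain S where S: "S \<in> Pi\<^sub>E C P"
    and avoid: "\<And>A X B Y. ((A, X), (B, Y)) \<in> F \<Longrightarrow> \<not> (S A = X \<and> S B = Y)"
    using choice_avoiding_pairs[of C n P F] assms(1) P \<open>finite F\<close> cardF F
    unfolding n_def by (metis add_gr_0 zero_less_one)
  have SP: "S A \<in> P A" if "A \<in> C" for A using S that by auto
  show ?thesis
  proof (rule that)
    show "S A \<subseteq> A \<and> card (S A) = p" if "A \<in> C" for A using block SP that by blast
  next
    fix A u v f
    assume A: "A \<in> C" and uv: "u \<in> S A" "v \<in> S A" and f: "f \<in> E" "f \<subseteq> (\<Union>B\<in>C. S B)"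
    show "\<psi> f \<noteq> \<psi> {u, v}"
    proof
      assume col: "\<psi> f = \<psi> {u, v}"
      let ?d = "(A, S A, u, v)"
      have "\<not> f \<subseteq> A" using E f(1) A by metis
      then obtain w B where "w \<in> f" "w \<notin> A" "B \<in> C" "w \<in> S B" using f(2) by blast
      then have "conflict ?d (B, S B)"
        using SP f(1) col block unfolding conflict_def by fastforce
      then have "?d \<in> D" using A uv SP unfolding D_def by blast
      obtain B' Y where BY: "g ?d = (B', Y)" by fastforce
      have inF: "((A, S A), (B', Y)) \<in> F"
        using \<open>?d \<in> D\<close> BY unfolding F_def by (force intro: rev_image_eqI)
      have "conflict ?d (B', Y)" using g[OF \<open>?d \<in> D\<close>] BY by simp
      then obtain f' w' where w': "B' \<in> C" "Y \<in> P B'" "f' \<in> E" "w' \<in> f'" "w' \<in> Y" "\<psi> f' = \<psi> {u, v}"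
        unfolding conflict_def by auto
      \<comment> \<open>The endpoint \<open>w'\<close> picked by \<open>g\<close> need not be \<open>w\<close>, but it belongs to the same edge, all of
        which lies in the chosen blocks.\<close>
      have "f' = f" using inj w'(3,6) f(1) col by (simp add: inj_on_def)
      then obtain B'' where "B'' \<in> C" "w' \<in> S B''" using f(2) w'(4) by blast
      then have "S B' = Y" using same[of B'' B' "S B''" Y w'] SP w' by blast
      then show False using avoid[OF inF] by blast
    qed
  qed
qed

theorem theorem3p2:
  fixes m p :: nat
  assumes "m > 0" and "p > 0"
  shows "\<exists>q>0. \<forall>(\<psi> :: nat set \<Rightarrow> 'c) K C.
    complete_multipartite m q C K \<and>
    spanning_subgraph K (complete_graph {..<q * m}) \<and>
    rainbow \<psi> K \<longrightarrow>
    (\<exists>K' C'.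
       complete_multipartite m p C' K' \<and>
       subgraph K' K \<and>
       rainbow \<psi> K' \<and>
       \<psi> ` edges_inside (complete_graph {..<q * m}) C' \<inter> \<psi> ` edges K' = {})"
proof (intro exI[of _ "(m * p\<^sup>2 + 1) * p"] conjI allI impI)
  let ?q = "(m * p\<^sup>2 + 1) * p"
  show "?q > 0" using assms by simp
  fix \<psi> :: "nat set \<Rightarrow> 'c" and K C
  assume "complete_multipartite m ?q C K \<and>
    spanning_subgraph K (complete_graph {..<?q * m}) \<and> rainbow \<psi> K"
  then have C: "finite C" "card C = m" "\<And>A. A \<in> C \<Longrightarrow> finite A \<and> card A = ?q" "disjoint C"
    and V: "verts K = \<Union>C"
    and edges: "edges K = {{u, v} | u v. \<exists>A\<in>C. \<exists>B\<in>C. A \<noteq> B \<and> u \<in> A \<and> v \<in> B}"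
    and inj: "inj_on \<psi> (edges K)"
    unfolding complete_multipartite_def rainbow_def by auto
  have cross: "\<exists>w z. f = {w, z} \<and> (\<forall>A\<in>C. \<not> {w, z} \<subseteq> A)" if f: "f \<in> edges K" for f
  proof -
    obtain u v A B where uv: "f = {u, v}" "A \<in> C" "B \<in> C" "A \<noteq> B" "u \<in> A" "v \<in> B"
      using f unfolding edges by auto
    have "\<not> {u, v} \<subseteq> D" if "D \<in> C" for D
      using uv(2-6) that C(4) unfolding disjoint_def by (metis disjoint_iff insert_subset)
    then show ?thesis using uv(1) by blast
  qed
  obtain S where S: "\<And>A. A \<in> C \<Longrightarrow> S A \<subseteq> A \<and> card (S A) = p"
    and avoid: "\<And>A u v f. \<lbrakk>A \<in> C; u \<in> S A; v \<in> S A; f \<in> edges K; f \<subseteq> (\<Union>B\<in>C. S B)\<rbrakk>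
      \<Longrightarrow> \<psi> f \<noteq> \<psi> {u, v}"
    using classes_avoiding_inner_colors[of C p \<psi> "edges K"] C assms(2) inj cross by blast
  have apart: "S A \<inter> S B = {}" if "A \<in> C" "B \<in> C" "A \<noteq> B" for A B
    using that S C(4) unfolding disjoint_def by blast
  have "inj_on S C"
    using apart S assms(2) by (metis card.empty inf.idem inj_onI less_irrefl)
  define C' where "C' = S ` C"
  define K' where
    "K' = (\<Union>C', {{u, v} | u v. \<exists>A\<in>C'. \<exists>B\<in>C'. A \<noteq> B \<and> u \<in> A \<and> v \<in> B})"
  have "complete_multipartite m p C' K'"
  proof -
    have "disjoint C'" using apart unfolding C'_def disjoint_def by blast
    moreover have "card C' = m" unfolding C'_def using C(2) \<open>inj_on S C\<close> by (simp add: card_image)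
    moreover have "finite A \<and> card A = p" if "A \<in> C'" for A
      using that S assms(2) unfolding C'_def by (metis card_ge_0_finite imageE)
    ultimately show ?thesis
      using C(1) unfolding complete_multipartite_def K'_def C'_def by simp
  qed
  moreover have sub: "subgraph K' K"
  proof -
    have "edges K' \<subseteq> edges K"
    proof
      fix e assume "e \<in> edges K'"
      then obtain u v A' B' where e: "e = {u, v}" "A' \<in> C'" "B' \<in> C'" "A' \<noteq> B'" "u \<in> A'" "v \<in> B'"
        unfolding K'_def by auto
      then obtain A B where AB: "A \<in> C" "A' = S A" "B \<in> C" "B' = S B" unfolding C'_def by auto
      then have "A \<noteq> B" "u \<in> A" "v \<in> B" using e(4-6) S by auto
      then show "e \<in> edges K" unfolding edges mem_Collect_eq using e(1) AB(1,3) by metis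
    qed
    moreover have "verts K' \<subseteq> verts K" unfolding K'_def C'_def V using S by auto
    ultimately show ?thesis unfolding subgraph_def by blast
  qed
  moreover have "rainbow \<psi> K'"
    using inj sub unfolding rainbow_def subgraph_def by (blast intro: inj_on_subset)
  moreover have "\<psi> e \<noteq> \<psi> f"
    if e: "e \<in> edges_inside (complete_graph {..<?q * m}) C'" and f: "f \<in> edges K'" for e f
  proof -
    obtain u v A where "e = {u, v}" "A \<in> C" "u \<in> S A" "v \<in> S A"
      using e unfolding edges_inside_def complete_graph_def C'_def by auto
    moreover have "f \<subseteq> (\<Union>B\<in>C. S B)" using f unfolding K'_def C'_def by auto
    moreover have "f \<in> edges K" using f sub unfolding subgraph_def by blast
    ultimately show ?thesis using avoid[of A u v f] by metis
  qed
  ultimately show "\<exists>K' C'. complete_multipartite m p C' K' \<and> subgraph K' K \<and> rainbow \<psi> K' \<and>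
      \<psi> ` edges_inside (complete_graph {..<?q * m}) C' \<inter> \<psi> ` edges K' = {}"
    by (intro exI[of _ K'] exI[of _ C']) blast
qed

end
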